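(* Let $n\ge 2$ be an integer and let $G\cong\Gamma(\mathbb{Z}_n)$ be the comaximal graph of $\mathbb{Z}_n$. Let $G_2$ be the graph associated with $n$ defined in the context. Then the following hold. (i) If $n$ is a product of distinct primes, then the independent domination polynomial of $G$ is $$D_i(G,x)=\phi(n)x+x\,g(x),$$ where $g(x)$ is the independent domination polynomial of $G_2$. (ii) If $n=p_1^{n_1}p_2^{n_2}\cdots p_k^{n_k}$ with $p_1,\dots,p_k$ distinct primes and $n_1,\dots,n_k$ positive integers, then the independent domination polynomial of $G$ is $$D_i(G,x)=\phi(n)x+x^{p_1^{n_1-1}p_2^{n_2-1}\cdots p_k^{n_k-1}}f(x),$$ where $f(x)$ is the independent domination polynomial of the connected component of $G_2$ that remains after all isolated vertices of $G_2$ are deleted.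
   Context: For a commutative ring $R$ with identity $1\ne 0$, the comaximal graph $\Gamma(R)$ is the simple graph with vertex set $R$ in which two distinct vertices $a,b$ are adjacent if and only if $aR+bR=R$. $\phi$ is Euler's totient function. A set $S\subseteq V(G)$ is dominating if every vertex of $V(G)\setminus S$ is adjacent to at least one vertex of $S$; it is independent if its elements are pairwise non-adjacent; it is an independent dominating set if it is both. The independent domination polynomial is $D_i(G,x)=\sum_k d_i(G,k)x^k$, where $d_i(G,k)$ is the number of independent dominating sets of $G$ of cardinality $k$. For the graph with no vertices the polynomial is taken to be $1$. Let $d_1,\dots,d_t$ be the proper divisors of $n$ (divisors other than $1$ and $n$). $G_n$ is the simple graph with vertex set $\{d_1,\dots,d_t\}$ in which distinct $d_i,d_j$ are adjacent iff $\gcd(d_i,d_j)=1$. The graph $G_2=G_n\big[\overline{K}_{\phi(n/d_1)},\dots,\overline{K}_{\phi(n/d_t)}\big]$ is the joined union: each vertex $d_i$ of $G_n$ is replaced by an edgeless graph on $\phi(n/d_i)$ vertices, and every vertex of the part replacing $d_i$ is joined to every vertex of the part replacing $d_j$ exactly when $d_i\sim d_j$ in $G_n$. Equivalently, $G_2$ is the subgraph of $\Gamma(\mathbb{Z}_n)$ induced by the nonzero non-units, the part of $d_i$ being $A_{d_i}=\{x\in\mathbb{Z}_n:\gcd(x,n)=d_i\}$. If $G_2$ has no vertices, or has only isolated vertices, then the component referred to in (ii) is the graph with no vertices. *)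

theory Defs
  imports
    "Graph_Theory.Graph_Theory"
    "HOL-Number_Theory.Number_Theory"
    "HOL-Computational_Algebra.Polynomial"
begin

text \<open>
  A simple graph is represented as a loop-free symmetric digraph without parallel arcs
  (locale \<^locale>\<open>pair_graph\<close>): the edge \<open>{u, v}\<close> is the pair of arcs \<open>(u, v)\<close>, \<open>(v, u)\<close>.
  On such digraphs the strongly connected components are the connected components, and
  \<^const>\<open>digraph_iso\<close> is isomorphism of simple graphs.
\<close>

definition comaximal_graph :: "('a, 'b) ring_scheme \<Rightarrow> 'a pair_pre_digraph" where
  "comaximal_graph R =
     \<lparr> pverts = carrier R,
       parcs = {(a, b). a \<in> carrier R \<and> b \<in> carrier R \<and> a \<noteq> b \<and>
                  PIdl\<^bsub>R\<^esub> a <+>\<^bsub>R\<^esub> PIdl\<^bsub>R\<^esub> b = carrier R} \<rparr>"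

definition independent_set :: "('a, 'b) pre_digraph \<Rightarrow> 'a set \<Rightarrow> bool" where
  "independent_set G S \<longleftrightarrow> S \<subseteq> verts G \<and> (\<forall>u\<in>S. \<forall>v\<in>S. \<not> u \<rightarrow>\<^bsub>G\<^esub> v)"

definition dominating_set :: "('a, 'b) pre_digraph \<Rightarrow> 'a set \<Rightarrow> bool" where
  "dominating_set G S \<longleftrightarrow> S \<subseteq> verts G \<and> (\<forall>v\<in>verts G - S. \<exists>u\<in>S. v \<rightarrow>\<^bsub>G\<^esub> u)"

definition indep_dom_count :: "('a, 'b) pre_digraph \<Rightarrow> nat \<Rightarrow> nat" where
  "indep_dom_count G k = card {S. independent_set G S \<and> dominating_set G S \<and> card S = k}"

definition indep_dom_poly :: "('a, 'b) pre_digraph \<Rightarrow> int poly" where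
  "indep_dom_poly G = (\<Sum>k\<le>card (verts G). monom (int (indep_dom_count G k)) k)"

text \<open>The convention for the graph without vertices holds because its empty set of
  vertices is independent and dominating.\<close>

lemma indep_dom_poly_no_verts:
  assumes "verts G = {}"
  shows "indep_dom_poly G = 1"
proof -
  have "{S. independent_set G S \<and> dominating_set G S \<and> card S = 0} = {{}}"
    using assms by (auto simp: independent_set_def dominating_set_def)
  then show ?thesis
    using assms by (simp add: indep_dom_poly_def indep_dom_count_def)
qed

text \<open>\<open>joined_union G H\<close> is $G[H_{v_1}, \dots, H_{v_t}]$ for \<open>V(G) = {v\<^sub>1, \<dots>, v\<^sub>t}\<close>; its
  vertices are tagged with the part they lie in.\<close>

definition joined_union ::
    "'a pair_pre_digraph \<Rightarrow> ('a \<Rightarrow> 'b pair_pre_digraph) \<Rightarrow> ('a \<times> 'b) pair_pre_digraph" where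
  "joined_union G H =
     \<lparr> pverts = (SIGMA u:pverts G. pverts (H u)),
       parcs = {((u, a), (v, b)). u \<in> pverts G \<and> v \<in> pverts G \<and>
                  a \<in> pverts (H u) \<and> b \<in> pverts (H v) \<and>
                  ((u, v) \<in> parcs G \<or> u = v \<and> (a, b) \<in> parcs (H u))} \<rparr>"

definition edgeless_graph :: "nat \<Rightarrow> nat pair_pre_digraph" where
  "edgeless_graph m = \<lparr> pverts = {..<m}, parcs = {} \<rparr>"

definition proper_divisor_graph :: "nat \<Rightarrow> nat pair_pre_digraph" where
  "proper_divisor_graph n =
     (let D = {d. d dvd n \<and> d \<noteq> 1 \<and> d \<noteq> n}
      in \<lparr> pverts = D, parcs = {(d, e). d \<in> D \<and> e \<in> D \<and> d \<noteq> e \<and> gcd d e = 1} \<rparr>)"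

definition graph_G2 :: "nat \<Rightarrow> (nat \<times> nat) pair_pre_digraph" where
  "graph_G2 n =
     joined_union (proper_divisor_graph n) (\<lambda>d. edgeless_graph (totient (n div d)))"

definition isolated_verts :: "('a, 'b) pre_digraph \<Rightarrow> 'a set" where
  "isolated_verts G = {v \<in> verts G. \<not> (\<exists>u\<in>verts G. v \<rightarrow>\<^bsub>G\<^esub> u)}"

definition delete_isolated :: "('a, 'b) pre_digraph \<Rightarrow> ('a, 'b) pre_digraph" where
  "delete_isolated G = G \<restriction> (verts G - isolated_verts G)"

end

theory Submission
  imports Defs
begin

text \<open>
  A unit of $\mathbb{Z}_n$ is adjacent to every other vertex, so it forms an independent
  dominating set by itself, and it lies in no other one. The remaining independent dominating
  sets are those of the graph on the non-units, which is $G_2$ together with the isolated vertex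
  $0$. Isolated vertices belong to every independent dominating set. The vertices of $G_2$ in the
  part of a divisor $d$ are isolated exactly if the radical of $n$ divides $d$; there are
  $n / \mathrm{rad}(n) - 1$ of them because $\sum_{c \mid m} \phi(c) = m$. A non-isolated vertex
  is adjacent to some prime divisor of $n$, and the prime divisors of $n$ are pairwise adjacent,
  so the rest of $G_2$ is connected.
\<close>

section \<open>Independent dominating sets and their generating function\<close>

lemma dominates_induce_subgraph_iff:
  "u \<rightarrow>\<^bsub>G \<restriction> V\<^esub> v \<longleftrightarrow> u \<in> V \<and> v \<in> V \<and> u \<rightarrow>\<^bsub>G\<^esub> v"
  by (auto simp: arcs_ends_conv)

text \<open>Collecting the sets of all sizes at once lets decompositions of a graph be stated as set
  equations.\<close>

definition indep_dom_sets :: "('a, 'b) pre_digraph \<Rightarrow> 'a set set" where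
  "indep_dom_sets G = {S. independent_set G S \<and> dominating_set G S}"

lemma indep_dom_sets_iff:
  "S \<in> indep_dom_sets G \<longleftrightarrow> S \<subseteq> verts G \<and> (\<forall>u\<in>S. \<forall>v\<in>S. \<not> u \<rightarrow>\<^bsub>G\<^esub> v) \<and>
     (\<forall>v\<in>verts G - S. \<exists>u\<in>S. v \<rightarrow>\<^bsub>G\<^esub> u)"
  by (auto simp: indep_dom_sets_def independent_set_def dominating_set_def)

lemma finite_indep_dom_sets:
  assumes "finite (verts G)"
  shows "finite (indep_dom_sets G)"
  by (rule finite_subset[of _ "Pow (verts G)"]) (use assms in \<open>auto simp: indep_dom_sets_iff\<close>)

text \<open>Grouping the sets by cardinality gives the coefficients. In this form a disjoint union
  of families becomes a sum of polynomials, and adjoining a fixed disjoint set becomes a power of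
  \<open>[:0, 1:]\<close> as a factor.\<close>

lemma indep_dom_poly_altdef:
  assumes "finite (verts G)"
  shows "indep_dom_poly G = (\<Sum>S\<in>indep_dom_sets G. [:0, 1:] ^ card S)"
proof -
  have "indep_dom_poly G =
      (\<Sum>k\<le>card (verts G). \<Sum>S\<in>{S\<in>indep_dom_sets G. card S = k}. [:0, 1:] ^ card S)"
    unfolding indep_dom_poly_def
  proof (rule sum.cong)
    fix k
    have "{S. independent_set G S \<and> dominating_set G S \<and> card S = k} =
        {S\<in>indep_dom_sets G. card S = k}"
      by (auto simp: indep_dom_sets_def)
    then show "monom (int (indep_dom_count G k)) k =
        (\<Sum>S\<in>{S\<in>indep_dom_sets G. card S = k}. [:0, 1:] ^ card S)"
      by (simp add: indep_dom_count_def monom_altdef of_nat_poly)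
  qed simp
  also have "\<dots> = (\<Sum>S\<in>indep_dom_sets G. [:0, 1:] ^ card S)"
    by (rule sum.group)
      (use assms in \<open>auto simp: finite_indep_dom_sets indep_dom_sets_iff intro: card_mono\<close>)
  finally show ?thesis .
qed

section \<open>Invariance under isomorphism\<close>

text \<open>Only adjacency of vertices is compared, so this serves both an abstract
  \<open>digraph_iso\<close> and the explicit bijection from \<open>graph_G2\<close> to the nonzero
  non-units.\<close>

lemma indep_dom_poly_cong:
  assumes bij: "bij_betw f (verts G) (verts H)"
    and adj: "\<And>u v. u \<in> verts G \<Longrightarrow> v \<in> verts G \<Longrightarrow> f u \<rightarrow>\<^bsub>H\<^esub> f v \<longleftrightarrow> u \<rightarrow>\<^bsub>G\<^esub> v"
  shows "indep_dom_poly G = indep_dom_poly H"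
proof -
  have inj: "inj_on f (verts G)" and img: "f ` verts G = verts H"
    using bij by (auto simp: bij_betw_def)
  have iff: "f ` S \<in> indep_dom_sets H \<longleftrightarrow> S \<in> indep_dom_sets G" if "S \<subseteq> verts G" for S
  proof -
    have "verts H - f ` S = f ` (verts G - S)"
      using inj img that by (metis inj_on_image_set_diff Diff_subset)
    moreover have "f ` S \<subseteq> verts H"
      using img that by blast
    moreover have "(\<forall>u\<in>S. \<forall>v\<in>S. \<not> f u \<rightarrow>\<^bsub>H\<^esub> f v) \<longleftrightarrow> (\<forall>u\<in>S. \<forall>v\<in>S. \<not> u \<rightarrow>\<^bsub>G\<^esub> v)"
      using adj that by blast
    moreover have "(\<forall>v\<in>verts G - S. \<exists>u\<in>S. f v \<rightarrow>\<^bsub>H\<^esub> f u) \<longleftrightarrow>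
        (\<forall>v\<in>verts G - S. \<exists>u\<in>S. v \<rightarrow>\<^bsub>G\<^esub> u)"
      using adj that by (meson DiffD1 subsetD)
    ultimately show ?thesis
      using that by (simp add: indep_dom_sets_iff)
  qed
  \<comment> \<open>The counts are compared size by size, because the generating-function form
    assumes a finite vertex set.\<close>
  have "indep_dom_count G k = indep_dom_count H k" for k
  proof -
    have "bij_betw ((`) f) {S\<in>indep_dom_sets G. card S = k} {S\<in>indep_dom_sets H. card S = k}"
    proof (rule bij_betw_imageI)
      show "inj_on ((`) f) {S\<in>indep_dom_sets G. card S = k}"
        by (rule inj_on_subset[OF inj_on_image_Pow[OF inj]]) (auto simp: indep_dom_sets_iff)
      have card: "card (f ` S) = card S" if "S \<subseteq> verts G" for S
        using that inj by (meson card_image inj_on_subset)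
      show "(`) f ` {S\<in>indep_dom_sets G. card S = k} = {S\<in>indep_dom_sets H. card S = k}"
      proof (intro equalityI subsetI)
        fix T assume T: "T \<in> {S\<in>indep_dom_sets H. card S = k}"
        then have "T \<subseteq> f ` verts G"
          using img by (auto simp: indep_dom_sets_iff)
        then obtain S where S: "S \<subseteq> verts G" "T = f ` S"
          by (meson subset_imageE)
        then show "T \<in> (`) f ` {S\<in>indep_dom_sets G. card S = k}"
          using T iff card by auto
      next
        fix T assume "T \<in> (`) f ` {S\<in>indep_dom_sets G. card S = k}"
        then obtain S where S: "S \<in> indep_dom_sets G" "card S = k" "T = f ` S"
          by blast
        moreover have "S \<subseteq> verts G"
          using S by (simp add: indep_dom_sets_iff)
        ultimately show "T \<in> {S\<in>indep_dom_sets H. card S = k}"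
          using iff card by simp
      qed
    qed
    then show ?thesis
      using bij_betw_same_card by (fastforce simp: indep_dom_count_def indep_dom_sets_def)
  qed
  moreover have "card (verts G) = card (verts H)"
    using bij by (rule bij_betw_same_card)
  ultimately show ?thesis
    by (simp add: indep_dom_poly_def)
qed

lemma indep_dom_poly_digraph_iso:
  assumes "digraph_iso G H"
  shows "indep_dom_poly G = indep_dom_poly H"
proof -
  obtain h where h: "pre_digraph.digraph_isomorphism G h" and H: "H = app_iso h G"
    using assms by (auto simp: digraph_iso_def)
  interpret wf_digraph G
    using h by (simp add: pre_digraph.digraph_isomorphism_def)
  show ?thesis
  proof (rule indep_dom_poly_cong)
    show "bij_betw (iso_verts h) (verts G) (verts H)"
      using digraph_isomorphism_inj_on_verts[OF h] by (simp add: bij_betw_def H)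
    fix u v assume uv: "u \<in> verts G" "v \<in> verts G"
    \<comment> \<open>An arc of \<open>H\<close> is the image of some arc of \<open>G\<close>;
      injectivity of \<open>iso_verts h\<close> then identifies the ends of that arc with
      \<open>u\<close> and \<open>v\<close>.\<close>
    have "iso_verts h u \<rightarrow>\<^bsub>H\<^esub> iso_verts h v \<longleftrightarrow>
        (\<exists>x y. x \<rightarrow>\<^bsub>G\<^esub> y \<and> iso_verts h u = iso_verts h x \<and> iso_verts h v = iso_verts h y)"
      unfolding H arcs_ends_app_iso_eq[OF h] by auto
    also have "\<dots> \<longleftrightarrow> u \<rightarrow>\<^bsub>G\<^esub> v"
      using uv adj_in_verts iso_verts_eq_iff[OF h] by blast
    finally show "iso_verts h u \<rightarrow>\<^bsub>H\<^esub> iso_verts h v \<longleftrightarrow> u \<rightarrow>\<^bsub>G\<^esub> v" .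
  qed
qed

section \<open>Splitting off universal and isolated vertices\<close>

text \<open>An independent set that meets \<open>U\<close> is a singleton, and such a singleton
  dominates. The inclusion must be proper: for \<open>U = verts G\<close> the empty graph left over
  would contribute a spurious 1.\<close>

lemma indep_dom_poly_universal:
  assumes fin: "finite (verts G)" and U: "U \<subset> verts G"
    and loopfree: "\<And>v. \<not> v \<rightarrow>\<^bsub>G\<^esub> v"
    and sym: "\<And>u v. u \<rightarrow>\<^bsub>G\<^esub> v \<Longrightarrow> v \<rightarrow>\<^bsub>G\<^esub> u"
    and univ: "\<And>u v. u \<in> U \<Longrightarrow> v \<in> verts G \<Longrightarrow> v \<noteq> u \<Longrightarrow> v \<rightarrow>\<^bsub>G\<^esub> u"
  shows "indep_dom_poly G =
    smult (int (card U)) [:0, 1:] + indep_dom_poly (G \<restriction> (verts G - U))"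
proof -
  let ?W = "verts G - U"
  have split: "indep_dom_sets G = (\<lambda>u. {u}) ` U \<union> indep_dom_sets (G \<restriction> ?W)"
  proof (intro equalityI subsetI)
    fix S assume S: "S \<in> indep_dom_sets G"
    show "S \<in> (\<lambda>u. {u}) ` U \<union> indep_dom_sets (G \<restriction> ?W)"
    proof (cases "S \<inter> U = {}")
      case True
      then show ?thesis
        using S unfolding indep_dom_sets_iff dominates_induce_subgraph_iff Un_iff
        by (intro disjI2) (simp, blast)
    next
      case False
      then obtain u where u: "u \<in> S" "u \<in> U"
        by blast
      then have "S = {u}"
        using S univ unfolding indep_dom_sets_iff by blast
      then show ?thesis
        using u by blast
    qed
  next
    fix S assume "S \<in> (\<lambda>u. {u}) ` U \<union> indep_dom_sets (G \<restriction> ?W)"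
    then show "S \<in> indep_dom_sets G"
    proof
      assume "S \<in> (\<lambda>u. {u}) ` U"
      then show ?thesis
        using U loopfree univ by (auto simp: indep_dom_sets_iff)
    next
      assume S: "S \<in> indep_dom_sets (G \<restriction> ?W)"
      \<comment> \<open>\<open>S\<close> dominates the nonempty set \<open>?W\<close>; any element
        of \<open>S\<close> then dominates all of \<open>U\<close>.\<close>
      have "S \<noteq> {}"
        using S U by (auto simp: indep_dom_sets_iff)
      moreover have "S \<subseteq> ?W"
        using S by (simp add: indep_dom_sets_iff)
      ultimately have "\<exists>u\<in>S. v \<rightarrow>\<^bsub>G\<^esub> u" if "v \<in> U" for v
        using sym univ that by (metis DiffE all_not_in_conv subsetD)
      moreover have "\<forall>u\<in>S. \<forall>v\<in>S. \<not> u \<rightarrow>\<^bsub>G\<^esub> v" and "\<forall>v\<in>?W - S. \<exists>u\<in>S. v \<rightarrow>\<^bsub>G\<^esub> u"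
        using S unfolding indep_dom_sets_iff dominates_induce_subgraph_iff
        by (simp_all add: subset_iff) blast+
      ultimately show ?thesis
        using \<open>S \<subseteq> ?W\<close> unfolding indep_dom_sets_iff by blast
    qed
  qed
  have finW: "finite (verts (G \<restriction> ?W))"
    using fin by simp
  have "indep_dom_poly G =
      (\<Sum>S\<in>(\<lambda>u. {u}) ` U. [:0, 1:] ^ card S) + (\<Sum>S\<in>indep_dom_sets (G \<restriction> ?W). [:0, 1:] ^ card S)"
    unfolding indep_dom_poly_altdef[OF fin] split
    by (rule sum.union_disjoint)
      (use fin U finite_indep_dom_sets[OF finW] in
        \<open>auto simp: indep_dom_sets_iff intro: finite_subset\<close>)
  also have "(\<Sum>S\<in>(\<lambda>u. {u}) ` U. [:0, 1:] ^ card S) = smult (int (card U)) [:0, 1:]"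
    by (subst sum.reindex) (auto simp: of_nat_poly)
  finally show ?thesis
    by (simp add: indep_dom_poly_altdef[OF finW])
qed

text \<open>An isolated vertex can be dominated only by belonging to the set, so \<open>T\<close>
  \<mapsto> \<open>I \<union> T\<close> is a bijection onto the independent dominating sets of
  \<open>G\<close>. Any set \<open>I\<close> of isolated vertices is allowed; it is applied both to
  the vertex 0 and to all isolated vertices of \<open>graph_G2\<close>.\<close>

lemma indep_dom_poly_isolated:
  assumes fin: "finite (verts G)" and I: "I \<subseteq> isolated_verts G"
    and sym: "\<And>u v. u \<rightarrow>\<^bsub>G\<^esub> v \<Longrightarrow> v \<rightarrow>\<^bsub>G\<^esub> u"
  shows "indep_dom_poly G = [:0, 1:] ^ card I * indep_dom_poly (G \<restriction> (verts G - I))"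
proof -
  let ?W = "verts G - I"
  have IV: "I \<subseteq> verts G" and iso: "\<And>i v. i \<in> I \<Longrightarrow> v \<in> verts G \<Longrightarrow> \<not> i \<rightarrow>\<^bsub>G\<^esub> v \<and> \<not> v \<rightarrow>\<^bsub>G\<^esub> i"
    using I sym unfolding isolated_verts_def by blast+
  have finW: "finite (verts (G \<restriction> ?W))"
    using fin by simp
  have split: "indep_dom_sets G = (\<union>) I ` indep_dom_sets (G \<restriction> ?W)"
  proof (intro equalityI subsetI)
    fix S assume S: "S \<in> indep_dom_sets G"
    then have "I \<subseteq> S"
      using IV iso unfolding indep_dom_sets_iff by blast
    moreover have "S - I \<in> indep_dom_sets (G \<restriction> ?W)"
      using S iso unfolding indep_dom_sets_iff dominates_induce_subgraph_iff
      by (simp add: subset_iff) blast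
    ultimately show "S \<in> (\<union>) I ` indep_dom_sets (G \<restriction> ?W)"
      by (intro image_eqI[of _ _ "S - I"]) auto
  next
    fix S assume "S \<in> (\<union>) I ` indep_dom_sets (G \<restriction> ?W)"
    then obtain T where T: "T \<in> indep_dom_sets (G \<restriction> ?W)" and S: "S = I \<union> T"
      by blast
    have "T \<subseteq> ?W" and "\<forall>u\<in>T. \<forall>v\<in>T. \<not> u \<rightarrow>\<^bsub>G\<^esub> v" and "\<forall>v\<in>?W - T. \<exists>u\<in>T. v \<rightarrow>\<^bsub>G\<^esub> u"
      using T unfolding indep_dom_sets_iff dominates_induce_subgraph_iff
      by (simp_all add: subset_iff) blast+
    then show "S \<in> indep_dom_sets G"
      using IV iso unfolding indep_dom_sets_iff S by blast
  qed
  have disj: "I \<inter> T = {}" "finite T" if "T \<in> indep_dom_sets (G \<restriction> ?W)" for T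
    using that fin by (auto simp: indep_dom_sets_iff intro: finite_subset)
  have finI: "finite I"
    using fin IV by (rule finite_subset[rotated])
  have "inj_on ((\<union>) I) (indep_dom_sets (G \<restriction> ?W))"
    using disj by (intro inj_onI) blast
  then have "indep_dom_poly G = (\<Sum>T\<in>indep_dom_sets (G \<restriction> ?W). [:0, 1:] ^ card (I \<union> T))"
    by (simp add: indep_dom_poly_altdef[OF fin] split sum.reindex)
  also have "\<dots> = (\<Sum>T\<in>indep_dom_sets (G \<restriction> ?W). [:0, 1:] ^ card I * [:0, 1:] ^ card T)"
    by (rule sum.cong) (simp_all add: card_Un_disjoint disj finI power_add)
  finally show ?thesis
    by (simp add: indep_dom_poly_altdef[OF finW] sum_distrib_left)
qed

section \<open>The comaximal graph of the residue ring\<close>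

text \<open>The two ideals sum to the whole ring iff 1 is an integer combination of
  \<open>a\<close>, \<open>b\<close> and \<open>m\<close>, which by Bezout means that the three have
  no common factor.\<close>

lemma PIdl_residue_ring_comaximal_iff:
  fixes m :: int
  assumes "m > 1"
  shows "PIdl\<^bsub>residue_ring m\<^esub> a <+>\<^bsub>residue_ring m\<^esub> PIdl\<^bsub>residue_ring m\<^esub> b =
      carrier (residue_ring m) \<longleftrightarrow> coprime (gcd a b) m"
    (is "?S = ?C \<longleftrightarrow> _")
proof -
  have S: "?S = {(x * a + y * b) mod m | x y. x \<in> {0..m - 1} \<and> y \<in> {0..m - 1}}"
  proof -
    have "PIdl\<^bsub>residue_ring m\<^esub> c = (\<lambda>x. x * c mod m) ` {0..m - 1}" for c
      by (auto simp: cgenideal_def residue_ring_def)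
    moreover have "H <+>\<^bsub>residue_ring m\<^esub> K = {(h + k) mod m | h k. h \<in> H \<and> k \<in> K}" for H K
      unfolding set_add_def' by (auto simp: residue_ring_def)
    ultimately have "?S =
        {(x * a mod m + y * b mod m) mod m | x y. x \<in> {0..m - 1} \<and> y \<in> {0..m - 1}}"
      by (simp only:) blast
    then show ?thesis
      by (simp only: mod_add_eq)
  qed
  have C: "?C = {0..m - 1}"
    by (simp add: residue_ring_def)
  show ?thesis
  proof
    assume "?S = ?C"
    then have "1 \<in> ?S"
      using assms by (simp add: C)
    then obtain x y where "(x * a + y * b) mod m = 1"
      by (auto simp: S)
    \<comment> \<open>Lifting the congruence to an identity of integers shows that every common
      divisor of \<open>a\<close>, \<open>b\<close> and \<open>m\<close> divides 1.\<close>
    then have *: "1 = x * a + y * b - m * ((x * a + y * b) div m)"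
      by (simp add: minus_mult_div_eq_mod)
    show "coprime (gcd a b) m"
    proof (rule coprimeI)
      fix c assume "c dvd gcd a b" "c dvd m"
      then show "is_unit c"
        by (subst *) (simp add: dvd_add dvd_diff)
    qed
  next
    assume "coprime (gcd a b) m"
    then obtain s t where st: "s * gcd a b + t * m = 1"
      by (metis bezout_int coprime_iff_gcd_eq_1)
    obtain u v where uv: "u * a + v * b = gcd a b"
      using bezout_int by blast
    show "?S = ?C"
    proof (intro equalityI subsetI)
      fix c assume "c \<in> ?S"
      then show "c \<in> ?C"
        using assms by (auto simp: S C)
    next
      fix c assume c: "c \<in> ?C"
      \<comment> \<open>The Bezout coefficients of 1, scaled by \<open>c\<close> and reduced so that
        they lie in the carrier.\<close>
      let ?x = "(c * s * u) mod m" and ?y = "(c * s * v) mod m"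
      have "c * s * u * a + c * s * v * b = c * (s * gcd a b + t * m) + m * (- (c * t))"
        by (simp add: algebra_simps flip: uv)
      then have "c * s * u * a + c * s * v * b = c + m * (- (c * t))"
        by (simp only: st mult_1_right)
      then have "(?x * a + ?y * b) mod m = (c + m * (- (c * t))) mod m"
        by (metis mod_add_eq mod_mult_left_eq)
      also have "\<dots> = c"
        using c assms by (simp add: C mod_mult_self2 del: mult_minus_right)
      finally show "c \<in> ?S"
        using assms unfolding S
        by (intro CollectI exI[of _ ?x] exI[of _ ?y]) auto
    qed
  qed
qed

lemma comaximal_graph_residue_ring:
  fixes m :: int
  assumes "m > 1"
  shows "pverts (comaximal_graph (residue_ring m)) = {0..m - 1}"
    and "(a, b) \<in> parcs (comaximal_graph (residue_ring m)) \<longleftrightarrow>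
      a \<in> {0..m - 1} \<and> b \<in> {0..m - 1} \<and> a \<noteq> b \<and> coprime (gcd a b) m"
  using PIdl_residue_ring_comaximal_iff[OF assms]
  by (simp_all add: comaximal_graph_def residue_ring_def)

text \<open>\<open>totatives n\<close> ranges over 1 to \<open>n\<close>, the carrier over 0 to
  \<open>n - 1\<close>. For \<open>n \<ge> 2\<close> neither 0 nor \<open>n\<close> is coprime to
  \<open>n\<close>, so the two sets agree.\<close>

lemma card_units_residue_ring:
  assumes "n \<ge> 2"
  shows "card {a \<in> {0..int n - 1}. coprime a (int n)} = totient n"
proof -
  have "{a \<in> {0..int n - 1}. coprime a (int n)} = int ` totatives n"
  proof (intro equalityI subsetI)
    fix a assume a: "a \<in> {a \<in> {0..int n - 1}. coprime a (int n)}"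
    moreover have "a \<noteq> 0"
      using a assms by auto
    ultimately have "nat a \<in> totatives n"
      using coprime_int_iff[of "nat a" n] by (auto simp: totatives_def)
    then show "a \<in> int ` totatives n"
      using a by (intro image_eqI[of _ _ "nat a"]) auto
  next
    fix a assume "a \<in> int ` totatives n"
    then obtain k where k: "a = int k" "k \<in> totatives n"
      by blast
    moreover have "k < n"
      using assms k totatives_less by auto
    ultimately show "a \<in> {a \<in> {0..int n - 1}. coprime a (int n)}"
      by (auto simp: totatives_def)
  qed
  then show ?thesis
    by (simp add: card_image totient_def)
qed

section \<open>The graph \<open>graph_G2\<close> as the graph on the nonzero non-units\<close>

lemma graph_G2_simps:
  "pverts (graph_G2 n) = (SIGMA d:{d. d dvd n \<and> d \<noteq> 1 \<and> d \<noteq> n}. {..<totient (n div d)})"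
  "((d, i), (e, j)) \<in> parcs (graph_G2 n) \<longleftrightarrow>
     (d, i) \<in> pverts (graph_G2 n) \<and> (e, j) \<in> pverts (graph_G2 n) \<and> d \<noteq> e \<and> coprime d e"
  unfolding coprime_iff_gcd_eq_1
  by (auto simp: graph_G2_def joined_union_def proper_divisor_graph_def edgeless_graph_def)

lemma finite_graph_G2: "n > 0 \<Longrightarrow> finite (pverts (graph_G2 n))"
  by (auto simp: graph_G2_simps)

text \<open>No part of the joined union is empty, so \<open>(q, 0)\<close> can represent the part of
  a prime divisor \<open>q\<close>.\<close>

lemma totient_div_pos: "d dvd n \<Longrightarrow> n > 0 \<Longrightarrow> totient (n div d) > (0::nat)"
  by (auto elim!: dvdE)

text \<open>The residues whose gcd with \<open>n\<close> is \<open>d\<close> number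
  \<open>totient (n div d)\<close>, the size of the part of \<open>d\<close>. The second property
  keeps track of this \<open>d\<close>, from which adjacency is later read off.\<close>

lemma graph_G2_bij_nonunits:
  assumes "n \<ge> 2"
  obtains f where
    "bij_betw f (pverts (graph_G2 n)) {a \<in> {0..int n - 1}. a \<noteq> 0 \<and> \<not> coprime a (int n)}"
    "\<And>d i. (d, i) \<in> pverts (graph_G2 n) \<Longrightarrow> gcd (f (d, i)) (int n) = int d"
proof -
  \<comment> \<open>The range matches \<open>card_gcd_eq_totient\<close>. The value
    \<open>n\<close>, standing for 0, lies only in \<open>A n\<close>, and \<open>n\<close> is not a
    proper divisor.\<close>
  define A where "A d = {k \<in> {0<..n}. gcd k n = d}" for d
  have "\<exists>h. bij_betw h {..<totient (n div d)} (A d)" if "d dvd n" for d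
    using assms that ex_bij_betw_nat_finite[of "A d"] card_gcd_eq_totient[of n d]
    by (simp add: A_def lessThan_atLeast0)
  then obtain h where h: "\<And>d. d dvd n \<Longrightarrow> bij_betw (h d) {..<totient (n div d)} (A d)"
    by metis
  define f where "f = (\<lambda>(d, i). int (h d i))"
  have hA: "h d i \<in> A d" if "(d, i) \<in> pverts (graph_G2 n)" for d i
    using that bij_betwE[OF h[of d]] by (auto simp: graph_G2_simps)
  have f: "gcd (f (d, i)) (int n) = int d" if "(d, i) \<in> pverts (graph_G2 n)" for d i
    using hA[OF that] unfolding f_def A_def prod.case gcd_int_int_eq by simp
  have "bij_betw f (pverts (graph_G2 n)) {a \<in> {0..int n - 1}. a \<noteq> 0 \<and> \<not> coprime a (int n)}"
  proof (rule bij_betw_imageI)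
    show "inj_on f (pverts (graph_G2 n))"
    proof (rule inj_onI, clarify)
      fix d i e j
      assume di: "(d, i) \<in> pverts (graph_G2 n)" and ej: "(e, j) \<in> pverts (graph_G2 n)"
        and eq: "f (d, i) = f (e, j)"
      \<comment> \<open>Different parts have disjoint images because the gcd with \<open>n\<close>
        recovers the divisor.\<close>
      then have "d = e"
        using f[OF di] f[OF ej] by simp
      moreover have "d dvd n" "i < totient (n div d)" "j < totient (n div e)"
        using di ej by (auto simp: graph_G2_simps)
      ultimately show "d = e \<and> i = j"
        using eq h[of d] by (auto simp: f_def bij_betw_def dest: inj_onD)
    qed
    show "f ` pverts (graph_G2 n) = {a \<in> {0..int n - 1}. a \<noteq> 0 \<and> \<not> coprime a (int n)}"
    proof (intro equalityI subsetI)
      fix a assume "a \<in> f ` pverts (graph_G2 n)"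
      then obtain d i where di: "(d, i) \<in> pverts (graph_G2 n)" "a = f (d, i)"
        by auto
      have d: "d \<noteq> 1" "d \<noteq> n"
        using di by (auto simp: graph_G2_simps)
      have "h d i \<noteq> n"
        using hA[OF di(1)] d by (auto simp: A_def)
      then have "0 < a" "a < int n"
        using hA[OF di(1)] by (auto simp: di f_def A_def)
      moreover have "\<not> coprime a (int n)"
        using f[OF di(1)] d unfolding di(2) coprime_iff_gcd_eq_1 by simp
      ultimately show "a \<in> {a \<in> {0..int n - 1}. a \<noteq> 0 \<and> \<not> coprime a (int n)}"
        by simp
    next
      fix a assume a: "a \<in> {a \<in> {0..int n - 1}. a \<noteq> 0 \<and> \<not> coprime a (int n)}"
      define k where "k = nat a"
      have k: "a = int k" "0 < k" "k < n" "\<not> coprime k n"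
        using a coprime_int_iff[of "nat a" n] by (auto simp: k_def)
      define d where "d = gcd k n"
      \<comment> \<open>Together with \<open>k < n\<close> this rules out
        \<open>d = n\<close>.\<close>
      have "d \<le> k"
        using k by (simp add: d_def)
      then have d: "d dvd n" "d \<noteq> 1" "d \<noteq> n"
        using k(3,4) unfolding coprime_iff_gcd_eq_1 by (auto simp: d_def)
      have "k \<in> h d ` {..<totient (n div d)}"
        using h[OF d(1)] k by (simp add: bij_betw_def A_def d_def)
      then show "a \<in> f ` pverts (graph_G2 n)"
        using d k by (auto simp: graph_G2_simps f_def)
    qed
  qed
  then show thesis
    using f that by blast
qed

lemma sym_graph_G2: "(u, v) \<in> parcs (graph_G2 n) \<Longrightarrow> (v, u) \<in> parcs (graph_G2 n)"
  by (cases u; cases v) (simp add: graph_G2_simps coprime_commute)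

text \<open>A prime not dividing \<open>d\<close> is coprime to \<open>d\<close>. The vertices
  \<open>(q, 0)\<close> serve as standard neighbours, both for detecting isolated vertices and for
  building paths.\<close>

lemma adj_prime_graph_G2:
  assumes "n > 0" "(d, i) \<in> pverts (graph_G2 n)" "prime q" "q dvd n" "\<not> q dvd d"
  shows "((d, i), (q, 0)) \<in> parcs (graph_G2 n)"
proof -
  have "d \<noteq> 1" "d dvd n"
    using assms by (auto simp: graph_G2_simps)
  \<comment> \<open>If \<open>n\<close> were the prime \<open>q\<close>, its divisor
    \<open>d\<close> would be 1 or \<open>q\<close>, and \<open>q\<close> does not divide
    \<open>d\<close>.\<close>
  then have "q \<noteq> n"
    using assms by (metis prime_nat_iff)
  then have "(q, 0) \<in> pverts (graph_G2 n)"
    using assms totient_div_pos[of q n] by (auto simp: graph_G2_simps)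
  moreover have "coprime d q"
    using assms prime_imp_coprime[of q d] by (simp add: coprime_commute)
  ultimately show ?thesis
    using assms by (auto simp: graph_G2_simps(2))
qed

section \<open>Isolated vertices and the remaining component\<close>

text \<open>A prime divisor of \<open>n\<close> missing from \<open>d\<close> yields a neighbour.
  Conversely, a neighbouring divisor \<open>e\<close> is not 1, so it has a prime factor, which
  divides \<open>n\<close> but not \<open>d\<close>.\<close>

lemma isolated_verts_graph_G2:
  assumes "n > 0"
  shows "isolated_verts (with_proj (graph_G2 n)) =
    {(d, i) \<in> pverts (graph_G2 n). \<forall>q. prime q \<and> q dvd n \<longrightarrow> q dvd d}"
proof (intro equalityI subsetI)
  fix x assume x: "x \<in> isolated_verts (with_proj (graph_G2 n))"
  obtain d i where di: "x = (d, i)"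
    by (cases x)
  have "q dvd d" if "prime q" "q dvd n" for q
  proof (rule ccontr)
    assume "\<not> q dvd d"
    then have "((d, i), (q, 0)) \<in> parcs (graph_G2 n)"
      using x that assms by (intro adj_prime_graph_G2) (simp_all add: di isolated_verts_def)
    moreover from this have "(q, 0) \<in> pverts (graph_G2 n)"
      by (simp only: graph_G2_simps(2))
    ultimately show False
      using x by (auto simp: di isolated_verts_def)
  qed
  then show "x \<in> {(d, i) \<in> pverts (graph_G2 n). \<forall>q. prime q \<and> q dvd n \<longrightarrow> q dvd d}"
    using x by (simp add: di isolated_verts_def)
next
  fix x assume x: "x \<in> {(d, i) \<in> pverts (graph_G2 n). \<forall>q. prime q \<and> q dvd n \<longrightarrow> q dvd d}"
  obtain d i where di: "x = (d, i)"
    by (cases x)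
  have "((d, i), (e, j)) \<notin> parcs (graph_G2 n)" for e j
  proof
    assume "((d, i), (e, j)) \<in> parcs (graph_G2 n)"
    then have "(e, j) \<in> pverts (graph_G2 n)" and cop: "coprime d e"
      by (simp_all only: graph_G2_simps(2))
    then have "e dvd n" "e \<noteq> 1"
      by (auto simp: graph_G2_simps(1))
    then obtain q where "prime q" "q dvd e"
      using prime_factor_nat by blast
    then show False
      using cop x \<open>e dvd n\<close> by (metis (no_types, lifting) di case_prodD coprime_common_divisor
          dvd_trans mem_Collect_eq not_prime_unit)
  qed
  then show "x \<in> isolated_verts (with_proj (graph_G2 n))"
    using x by (auto simp: di isolated_verts_def)
qed

text \<open>Any two non-isolated vertices are joined by a walk through at most two prime
  vertices.\<close>

lemma delete_isolated_graph_G2_in_sccs: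
  assumes "n > 0" and ne: "verts (delete_isolated (with_proj (graph_G2 n))) \<noteq> {}"
  shows "delete_isolated (with_proj (graph_G2 n)) \<in> pre_digraph.sccs (with_proj (graph_G2 n))"
proof -
  let ?G = "with_proj (graph_G2 n)"
  let ?S = "verts ?G - isolated_verts ?G"
  interpret wf_digraph ?G
    by unfold_locales (auto simp: graph_G2_simps(2))
  have sym: "symmetric ?G"
    using sym_graph_G2 by (auto simp: symmetric_def sym_def)
  have "?S \<in> sccs_verts"
    unfolding sccs_verts_def
  proof (intro CollectI conjI ballI allI impI)
    show "?S \<noteq> {}"
      using ne by (simp add: delete_isolated_def)
  next
    fix u v assume u: "u \<in> ?S" and v: "v \<in> ?S"
    have prime_neighbour: "\<exists>q. prime q \<and> q dvd n \<and> x \<rightarrow>\<^bsub>?G\<^esub> (q, 0)" if "x \<in> ?S" for x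
      using that assms adj_prime_graph_G2
      by (cases x) (auto simp: isolated_verts_graph_G2)
    obtain q r where q: "prime q" "q dvd n" "u \<rightarrow>\<^bsub>?G\<^esub> (q, 0)"
      and r: "prime r" "r dvd n" "v \<rightarrow>\<^bsub>?G\<^esub> (r, 0)"
      using prime_neighbour[OF u] prime_neighbour[OF v] by blast
    have "(q, 0) \<rightarrow>\<^sup>*\<^bsub>?G\<^esub> (r, 0)"
    proof (cases "q = r")
      case True
      then show ?thesis
        using q adj_in_verts by auto
    next
      case False
      then have "\<not> r dvd q"
        using q r primes_dvd_imp_eq by blast
      moreover have "(q, 0) \<in> pverts (graph_G2 n)"
        using adj_in_verts(2)[OF q(3)] by simp
      ultimately have "(q, 0) \<rightarrow>\<^bsub>?G\<^esub> (r, 0)"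
        using r assms adj_prime_graph_G2 by simp
      then show ?thesis
        by blast
    qed
    moreover have "(r, 0) \<rightarrow>\<^sup>*\<^bsub>?G\<^esub> v"
      using r sym_graph_G2 by auto
    ultimately show "u \<rightarrow>\<^sup>*\<^bsub>?G\<^esub> v"
      using q adj_reachable_trans reachable_trans by blast
  next
    \<comment> \<open>Maximality: a vertex that reaches \<open>u\<close> is \<open>u\<close> itself
      or has a neighbour, so it lies in \<open>?S\<close>.\<close>
    fix u v assume u: "u \<in> ?S" and v: "v \<notin> ?S"
    have "\<not> v \<rightarrow>\<^sup>*\<^bsub>?G\<^esub> u"
    proof
      assume "v \<rightarrow>\<^sup>*\<^bsub>?G\<^esub> u"
      then show False
      proof (cases rule: converse_reachable_cases)
        case base
        then show ?thesis
          using u v by simp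
      next
        case (step w)
        then have "v \<notin> isolated_verts ?G" "v \<in> verts ?G"
          using adj_in_verts[OF step(1)] step(1) by (auto simp: isolated_verts_def)
        then show ?thesis
          using v by simp
      qed
    qed
    then show "\<not> u \<rightarrow>\<^sup>*\<^bsub>?G\<^esub> v \<or> \<not> v \<rightarrow>\<^sup>*\<^bsub>?G\<^esub> u"
      by blast
  qed
  then show ?thesis
    unfolding delete_isolated_def by (rule in_verts_sccsD_sccs)
qed

text \<open>Here \<open>r\<close> is the radical of \<open>n\<close>, specified by
  \<open>rad\<close>. The parts of the multiples \<open>d\<close> of \<open>r\<close> have sizes
  \<open>totient c\<close> with \<open>c = n div d\<close> running over the divisors of
  \<open>m\<close>; these sum to \<open>m\<close>, and excluding \<open>d = n\<close> removes
  \<open>totient 1 = 1\<close>.\<close>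

lemma card_isolated_verts_graph_G2:
  assumes n: "n \<ge> 2" "n = r * m"
    and rad: "\<And>d. r dvd d \<longleftrightarrow> (\<forall>q. prime q \<and> q dvd n \<longrightarrow> q dvd d)"
  shows "card (isolated_verts (with_proj (graph_G2 n))) = m - 1"
proof -
  have "n > 0"
    using n(1) by simp
  then have "r > 0" "m > 0"
    using n(2) by simp_all
  \<comment> \<open>This makes the condition \<open>d \<noteq> 1\<close> on vertices follow from
    \<open>r dvd d\<close>.\<close>
  have "r \<noteq> 1"
  proof
    assume "r = 1"
    have "n \<noteq> 1"
      using n(1) by simp
    then obtain q where "prime q" "q dvd n"
      using prime_factor_nat by blast
    then have "q dvd 1"
      using rad[of 1] \<open>r = 1\<close> by simp
    then show False
      using \<open>prime q\<close> not_prime_unit by blast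
  qed
  let ?D = "{d. d dvd n \<and> d \<noteq> n \<and> r dvd d}"
  have "isolated_verts (with_proj (graph_G2 n)) = (SIGMA d:?D. {..<totient (n div d)})"
    using n(1) \<open>r \<noteq> 1\<close> unfolding isolated_verts_graph_G2[OF \<open>n > 0\<close>] graph_G2_simps rad[symmetric]
    by auto
  moreover have "finite ?D"
    using \<open>n > 0\<close> by (intro finite_subset[OF _ finite_divisors_nat[of n]]) auto
  ultimately have "card (isolated_verts (with_proj (graph_G2 n))) = (\<Sum>d\<in>?D. totient (n div d))"
    by simp
  also have "\<dots> = (\<Sum>c\<in>{c. c dvd m} - {1}. totient c)"
  proof (rule sum.reindex_bij_witness[of _ "\<lambda>c. n div c" "\<lambda>d. n div d"])
    fix d assume d: "d \<in> ?D"
    then obtain k where k: "d = r * k"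
      by blast
    have "k dvd m"
      using d n \<open>r > 0\<close> by (simp add: k)
    then obtain l where l: "m = k * l"
      by blast
    have "k > 0" "l > 0"
      using \<open>m > 0\<close> l by auto
    have nd: "n div d = l"
      using n \<open>r > 0\<close> \<open>k > 0\<close> by (simp add: k l mult.assoc[symmetric])
    show "n div (n div d) = d"
      using \<open>l > 0\<close> n by (simp add: nd k l mult.assoc[symmetric])
    show "n div d \<in> {c. c dvd m} - {1}"
      using d n by (auto simp: nd k l)
  next
    fix c assume c: "c \<in> {c. c dvd m} - {1}"
    then obtain l where l: "m = c * l"
      by blast
    have "c > 0" "l > 0"
      using \<open>m > 0\<close> l by auto
    have nc: "n div c = r * l"
      using n \<open>c > 0\<close> by (simp add: l mult.left_commute)
    show "n div (n div c) = c"
      unfolding nc using n \<open>r > 0\<close> \<open>l > 0\<close>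
      by (metis l mult.left_commute mult.commute nat_0_less_mult_iff nonzero_mult_div_cancel_left neq0_conv)
    show "n div c \<in> ?D"
      using n(2) c \<open>r > 0\<close> \<open>c > 0\<close> \<open>l > 0\<close> by (auto simp: nc l)
  qed simp
  also have "\<dots> = (\<Sum>c | c dvd m. totient c) - totient 1"
    using \<open>m > 0\<close> by (subst sum_diff1_nat) auto
  finally show ?thesis
    by (simp add: totient_divisor_sum)
qed

text \<open>Injectivity makes the primes distinct, hence pairwise coprime, so their divisibilities
  combine.\<close>

lemma prod_primes_dvd_iff:
  fixes p :: "'i \<Rightarrow> nat"
  assumes "finite I" "inj_on p I" "\<And>i. i \<in> I \<Longrightarrow> prime (p i)"
  shows "(\<Prod>i\<in>I. p i) dvd d \<longleftrightarrow> (\<forall>i\<in>I. p i dvd d)"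
  using assms
proof (induction I rule: finite_induct)
  case (insert i I)
  have "coprime (p i) (\<Prod>j\<in>I. p j)"
  proof (rule prod_coprime_right)
    fix j assume "j \<in> I"
    then show "coprime (p i) (p j)"
      using insert.prems insert.hyps by (intro primes_coprime) (auto dest: inj_onD)
  qed
  then have "p i * (\<Prod>j\<in>I. p j) dvd d \<longleftrightarrow> p i dvd d \<and> (\<Prod>j\<in>I. p j) dvd d"
    using divides_mult dvd_mult_left dvd_mult_right by metis
  then show ?case
    using insert by simp
qed simp

section \<open>Assembling the polynomial identities\<close>

text \<open>The units are the universal vertices split off first; among the non-units, 0 is isolated
  and accounts for the factor \<open>[:0, 1:]\<close> in front of the polynomial of
  \<open>graph_G2\<close>.\<close>

lemma indep_dom_poly_comaximal_residue_ring:
  assumes n: "n \<ge> 2"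
  shows "indep_dom_poly (with_proj (comaximal_graph (residue_ring (int n)))) =
    smult (int (totient n)) [:0, 1:] + [:0, 1:] * indep_dom_poly (with_proj (graph_G2 n))"
proof -
  let ?C = "with_proj (comaximal_graph (residue_ring (int n)))"
  let ?U = "{a \<in> {0..int n - 1}. coprime a (int n)}"
  let ?W = "verts ?C - ?U"
  let ?H = "?C \<restriction> ?W"
  have "int n > 1"
    using n by simp
  note C = comaximal_graph_residue_ring[OF this]
  have sym: "v \<rightarrow>\<^bsub>?C\<^esub> u" if "u \<rightarrow>\<^bsub>?C\<^esub> v" for u v
    using that unfolding with_proj_simps C gcd.commute[of v u] by blast
  have symH: "v \<rightarrow>\<^bsub>?H\<^esub> u" if "u \<rightarrow>\<^bsub>?H\<^esub> v" for u v
    using that sym unfolding dominates_induce_subgraph_iff by blast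
  have not_coprime_0: "\<not> coprime 0 (int n)"
    using n by simp
  have "indep_dom_poly ?C = smult (int (card ?U)) [:0, 1:] + indep_dom_poly ?H"
  proof (rule indep_dom_poly_universal)
    show "v \<rightarrow>\<^bsub>?C\<^esub> u" if "u \<rightarrow>\<^bsub>?C\<^esub> v" for u v
      using that by (rule sym)
    \<comment> \<open>The non-unit 0 witnesses that the inclusion of the units is proper.\<close>
    have "0 \<in> verts ?C - ?U"
      using n not_coprime_0 by (simp add: C)
    then show "?U \<subset> verts ?C"
      unfolding with_proj_simps C by blast
    show "v \<rightarrow>\<^bsub>?C\<^esub> u" if "u \<in> ?U" "v \<in> verts ?C" "v \<noteq> u" for u v
    proof -
      have "coprime u (int n)"
        using that(1) by blast
      then have "coprime (gcd v u) (int n)"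
        by (rule coprime_divisors[rotated 2]) simp_all
      then show ?thesis
        using that unfolding with_proj_simps C by blast
    qed
  qed (simp_all add: C)
  moreover have "indep_dom_poly ?H =
      [:0, 1:] ^ card {0 :: int} * indep_dom_poly (?H \<restriction> (verts ?H - {0}))"
  proof (rule indep_dom_poly_isolated)
    show "v \<rightarrow>\<^bsub>?H\<^esub> u" if "u \<rightarrow>\<^bsub>?H\<^esub> v" for u v
      using that by (rule symH)
    show "{0} \<subseteq> isolated_verts ?H"
      using n not_coprime_0 by (auto simp: isolated_verts_def dominates_induce_subgraph_iff C)
  qed (simp add: C)
  moreover have "indep_dom_poly (with_proj (graph_G2 n)) = indep_dom_poly (?H \<restriction> (verts ?H - {0}))"
  proof -
    obtain f where bij: "bij_betw f (pverts (graph_G2 n))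
        {a \<in> {0..int n - 1}. a \<noteq> 0 \<and> \<not> coprime a (int n)}"
      and gcd_f: "\<And>d i. (d, i) \<in> pverts (graph_G2 n) \<Longrightarrow> gcd (f (d, i)) (int n) = int d"
      using graph_G2_bij_nonunits[OF n] by blast
    have vH: "verts (?H \<restriction> (verts ?H - {0})) = {a \<in> {0..int n - 1}. a \<noteq> 0 \<and> \<not> coprime a (int n)}"
      by (auto simp: C)
    show ?thesis
    proof (rule indep_dom_poly_cong)
      show "bij_betw f (verts (with_proj (graph_G2 n))) (verts (?H \<restriction> (verts ?H - {0})))"
        using bij unfolding vH by simp
      fix u v
      assume uv: "u \<in> verts (with_proj (graph_G2 n))" "v \<in> verts (with_proj (graph_G2 n))"
      obtain d i e j where de: "u = (d, i)" "v = (e, j)"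
        by (cases u; cases v)
      have fuv: "f u \<in> verts (?H \<restriction> (verts ?H - {0}))" "f v \<in> verts (?H \<restriction> (verts ?H - {0}))"
        using bij_betwE[OF bij] uv unfolding vH by simp_all
      \<comment> \<open>Whether two residues are comaximal depends only on their gcds with
        \<open>n\<close>, that is, on \<open>d\<close> and \<open>e\<close>.\<close>
      have "gcd (gcd (f u) (f v)) (int n) = gcd (gcd (f u) (int n)) (gcd (f v) (int n))"
        by (simp add: gcd.assoc gcd.left_commute)
      also have "\<dots> = int (gcd d e)"
        using uv by (simp add: de gcd_f)
      finally have cop: "coprime (gcd (f u) (f v)) (int n) \<longleftrightarrow> coprime d e"
        unfolding coprime_iff_gcd_eq_1 by simp
      have "d \<noteq> 1"
        using uv by (auto simp: de graph_G2_simps)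
      then have "d \<noteq> e" if "coprime d e"
        using that by auto
      moreover have "d = e" if "f u = f v"
        using that gcd_f[of d i] gcd_f[of e j] uv by (simp add: de)
      \<comment> \<open>One graph requires distinct residues, the other distinct divisors; for
        \<open>d \<noteq> 1\<close> coprimality implies both.\<close>
      ultimately have neq: "d \<noteq> e" "f u \<noteq> f v" if "coprime d e"
        using that by blast+
      have "f u \<rightarrow>\<^bsub>?H \<restriction> (verts ?H - {0})\<^esub> f v \<longleftrightarrow> f u \<noteq> f v \<and> coprime d e"
        using fuv unfolding dominates_induce_subgraph_iff with_proj_simps C cop
        by (simp only: induce_subgraph_verts) blast
      also have "\<dots> \<longleftrightarrow> u \<rightarrow>\<^bsub>with_proj (graph_G2 n)\<^esub> v"
        using uv neq unfolding de with_proj_simps graph_G2_simps(2) by blast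
      finally show "f u \<rightarrow>\<^bsub>?H \<restriction> (verts ?H - {0})\<^esub> f v \<longleftrightarrow> u \<rightarrow>\<^bsub>with_proj (graph_G2 n)\<^esub> v" .
    qed
  qed
  moreover have "card {0 :: int} = 1"
    by simp
  ultimately show ?thesis
    by (simp only: card_units_residue_ring[OF n] power_one_right)
qed

text \<open>The factor \<open>[:0, 1:]\<close> coming from the vertex 0 combines with the
  \<open>m - 1\<close> isolated vertices of \<open>graph_G2\<close> to the exponent
  \<open>m\<close>.\<close>

lemma indep_dom_poly_graph_G2:
  assumes n: "n \<ge> 2" "n = r * m"
    and rad: "\<And>d. r dvd d \<longleftrightarrow> (\<forall>q. prime q \<and> q dvd n \<longrightarrow> q dvd d)"
  shows "[:0, 1:] * indep_dom_poly (with_proj (graph_G2 n)) =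
    [:0, 1:] ^ m * indep_dom_poly (delete_isolated (with_proj (graph_G2 n)))"
proof -
  let ?I = "isolated_verts (with_proj (graph_G2 n))"
  have "indep_dom_poly (with_proj (graph_G2 n)) =
      [:0, 1:] ^ card ?I * indep_dom_poly (delete_isolated (with_proj (graph_G2 n)))"
    unfolding delete_isolated_def
    by (rule indep_dom_poly_isolated) (use n(1) in \<open>simp_all add: finite_graph_G2 sym_graph_G2\<close>)
  moreover have "Suc (card ?I) = m"
    using n card_isolated_verts_graph_G2[OF n rad] by (cases m) simp_all
  ultimately show ?thesis
    by (metis mult.assoc power_Suc)
qed

text \<open>Supplies the \<open>r\<close> and \<open>m\<close> of the preceding results: the prime
  divisors of \<open>n\<close> are exactly the \<open>p i\<close>, where \<open>e i > 0\<close>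
  ensures that each one occurs.\<close>

lemma prime_power_product_radical:
  fixes p e :: "'i \<Rightarrow> nat"
  assumes I: "finite I" "inj_on p I" and p: "\<And>i. i \<in> I \<Longrightarrow> prime (p i) \<and> e i > 0"
    and n: "n = (\<Prod>i\<in>I. p i ^ e i)"
  shows "n = (\<Prod>i\<in>I. p i) * (\<Prod>i\<in>I. p i ^ (e i - 1))"
    and "(\<Prod>i\<in>I. p i) dvd d \<longleftrightarrow> (\<forall>q. prime q \<and> q dvd n \<longrightarrow> q dvd d)"
proof -
  show "n = (\<Prod>i\<in>I. p i) * (\<Prod>i\<in>I. p i ^ (e i - 1))"
    unfolding n prod.distrib[symmetric]
    by (rule prod.cong) (use p in \<open>auto simp flip: power_Suc\<close>)
  have "prime q \<and> q dvd n \<longleftrightarrow> (\<exists>i\<in>I. q = p i)" for q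
  proof
    assume q: "prime q \<and> q dvd n"
    then obtain i where "i \<in> I" "q dvd p i ^ e i"
      using I by (auto simp: n prime_dvd_prod_iff)
    then show "\<exists>i\<in>I. q = p i"
      using q p prime_dvd_power primes_dvd_imp_eq by blast
  next
    assume "\<exists>i\<in>I. q = p i"
    then obtain i where i: "i \<in> I" "q = p i"
      by blast
    then have "q dvd p i ^ e i"
      using p by (simp add: dvd_power)
    moreover have "p i ^ e i dvd n"
      unfolding n using I(1) i(1) by (rule dvd_prodI)
    ultimately have "q dvd n"
      by (rule dvd_trans)
    then show "prime q \<and> q dvd n"
      using i p by simp
  qed
  moreover have "(\<Prod>i\<in>I. p i) dvd d \<longleftrightarrow> (\<forall>i\<in>I. p i dvd d)"
    using I p by (intro prod_primes_dvd_iff) auto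
  ultimately show "(\<Prod>i\<in>I. p i) dvd d \<longleftrightarrow> (\<forall>q. prime q \<and> q dvd n \<longrightarrow> q dvd d)"
    by (simp only:) blast
qed

theorem theorem2p2:
  fixes n :: nat and G :: "'a pair_pre_digraph"
  assumes "n \<ge> 2"
    and "pair_graph G"
    and "digraph_iso (with_proj G) (with_proj (comaximal_graph (residue_ring (int n))))"
  shows
    "(\<forall>(k::nat) (p :: nat \<Rightarrow> nat).
        inj_on p {1..k} \<and> (\<forall>i\<in>{1..k}. prime (p i)) \<and> n = (\<Prod>i\<in>{1..k}. p i) \<longrightarrow>
        indep_dom_poly (with_proj G) =
          smult (int (totient n)) [:0, 1:] + [:0, 1:] * indep_dom_poly (with_proj (graph_G2 n)))
     \<and>
     (\<forall>(k::nat) (p :: nat \<Rightarrow> nat) (e :: nat \<Rightarrow> nat).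
        inj_on p {1..k} \<and> (\<forall>i\<in>{1..k}. prime (p i) \<and> e i > 0) \<and> n = (\<Prod>i\<in>{1..k}. p i ^ e i) \<longrightarrow>
        (verts (delete_isolated (with_proj (graph_G2 n))) = {} \<or>
         delete_isolated (with_proj (graph_G2 n)) \<in> pre_digraph.sccs (with_proj (graph_G2 n))) \<and>
        indep_dom_poly (with_proj G) =
          smult (int (totient n)) [:0, 1:] +
          [:0, 1:] ^ (\<Prod>i\<in>{1..k}. p i ^ (e i - 1)) *
            indep_dom_poly (delete_isolated (with_proj (graph_G2 n))))"
proof (intro conjI allI impI)
  \<comment> \<open>Both parts start from this identity; for (ii) its last summand is rewritten by
    splitting off the isolated vertices.\<close>
  have poly_G: "indep_dom_poly (with_proj G) =
      smult (int (totient n)) [:0, 1:] + [:0, 1:] * indep_dom_poly (with_proj (graph_G2 n))"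
    using assms indep_dom_poly_digraph_iso indep_dom_poly_comaximal_residue_ring by metis
  then show "indep_dom_poly (with_proj G) =
      smult (int (totient n)) [:0, 1:] + [:0, 1:] * indep_dom_poly (with_proj (graph_G2 n))" .
  show "verts (delete_isolated (with_proj (graph_G2 n))) = {} \<or>
      delete_isolated (with_proj (graph_G2 n)) \<in> pre_digraph.sccs (with_proj (graph_G2 n))"
    using delete_isolated_graph_G2_in_sccs[of n] assms(1) by auto
  fix k :: nat and p e :: "nat \<Rightarrow> nat"
  assume *: "inj_on p {1..k} \<and> (\<forall>i\<in>{1..k}. prime (p i) \<and> e i > 0) \<and>
    n = (\<Prod>i\<in>{1..k}. p i ^ e i)"
  then have "inj_on p {1..k}" "\<And>i. i \<in> {1..k} \<Longrightarrow> prime (p i) \<and> e i > 0"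
    "n = (\<Prod>i\<in>{1..k}. p i ^ e i)"
    by blast+
  note radical = prime_power_product_radical[OF finite_atLeastAtMost this]
  show "indep_dom_poly (with_proj G) =
      smult (int (totient n)) [:0, 1:] +
      [:0, 1:] ^ (\<Prod>i\<in>{1..k}. p i ^ (e i - 1)) *
        indep_dom_poly (delete_isolated (with_proj (graph_G2 n)))"
    by (simp only: poly_G indep_dom_poly_graph_G2[OF assms(1) radical])
qed

end
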